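(* For $q>1$ and $|u|<1/q$, $$\sum_{n \geq 0} q^{n^2}u^n \left[ \sum_{\substack{0\le r\le n-1\\ r \text{ even}}} \frac{1}{A_r} + \sum_{\substack{1\le r\le n\\ r \text{ even}}} \frac{1}{B_r} + \sum_{\substack{1\le r\le n\\ r \text{ odd}}} \frac{1}{C_r} \right] = \frac{1}{2(1-uq)} \frac{\prod_{i \geq 1} (1+u/q^{2(i-1)})}{\prod_{i \geq 1} (1-u^2/q^{2(i-1)})} - \frac{1}{2} \frac{\prod_{i \geq 1} (1+u/q^{2i-1})}{\prod_{i \geq 1} (1-u^2/q^{2(i-1)})},$$ where (depending on $n$) $$A_r = q^{r(r-1)/2+r(2n-2r)}\, |Sp(r,q)|\, |O^-(2n-2r,q)|,$$ $$B_r = 2q^{r(r+1)/2+(r-1)(2n-2r)-1}\, |Sp(r-2,q)|\, |Sp(2n-2r,q)|,$$ $$C_r = 2q^{r(r-1)/2+(r-1)(2n-2r)}\, |Sp(r-1,q)|\, |Sp(2n-2r,q)|.$$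
   Context: Here $q$ is a real number, $u$ is a complex number, and the following symbols denote expressions in $q$ (which for prime powers $q$ are orders of finite classical groups): $|Sp(2m,q)|=q^{m^2}\prod_{i=1}^m (q^{2i}-1)$ for $m\ge 0$ (so $|Sp(0,q)|=1$); $|O^{-}(2m,q)|=\frac{2q^{m^2-m}}{q^m- 1}\prod_{i=1}^m (q^{2i}-1)$ for $m\ge 1$. Empty sums equal $0$. *)

theory Defs
  imports "HOL-Analysis.Analysis"
begin

(* The first argument of ord_Sp and ord_Om is the dimension d = 2m, as in |Sp(2m,q)|
   and |O^-(2m,q)|.  Only even d (and d >= 2 for ord_Om) are meaningful. *)

definition ord_Sp :: "nat \<Rightarrow> real \<Rightarrow> real" where
  "ord_Sp d q = (let m = d div 2 in q ^ (m\<^sup>2) * (\<Prod>i=1..m. (q ^ (2 * i) - 1)))"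

definition ord_Om :: "nat \<Rightarrow> real \<Rightarrow> real" where
  "ord_Om d q = (let m = d div 2 in
     2 * q ^ (m\<^sup>2 - m) / (q ^ m - 1) * (\<Prod>i=1..m. (q ^ (2 * i) - 1)))"

(* Natural-number subtraction agrees with the integer one in the ranges where these
   are used: even r < n for A, even r with 1 <= r <= n (hence r >= 2) for B,
   odd r <= n for C.  The only truncation is r - 1 at r = 0 in A, where it is
   multiplied by r = 0.  The divisions by 2 are exact. *)

definition A_term :: "real \<Rightarrow> nat \<Rightarrow> nat \<Rightarrow> real" where
  "A_term q n r = q ^ (r * (r - 1) div 2 + r * (2 * n - 2 * r))
     * ord_Sp r q * ord_Om (2 * n - 2 * r) q"

definition B_term :: "real \<Rightarrow> nat \<Rightarrow> nat \<Rightarrow> real" where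
  "B_term q n r = 2 * q ^ (r * (r + 1) div 2 + (r - 1) * (2 * n - 2 * r) - 1)
     * ord_Sp (r - 2) q * ord_Sp (2 * n - 2 * r) q"

definition C_term :: "real \<Rightarrow> nat \<Rightarrow> nat \<Rightarrow> real" where
  "C_term q n r = 2 * q ^ (r * (r - 1) div 2 + (r - 1) * (2 * n - 2 * r))
     * ord_Sp (r - 1) q * ord_Sp (2 * n - 2 * r) q"

end

(* Put p = 1/q^2 and (p)_k = (1 - p) ... (1 - p^k).  With r = 2s or r = 2s + 1 and
   m = n - r, the terms with index r contribute
     q^(n^2) (1/A_r + 1/B_r) = (q^n - 1) / (2 q^(m^2) (p)_s (p)_m)   and
     q^(n^2) / C_r = q^n / (2 q^(m^2) (p)_s (p)_m).
   Since q^(m - m^2) = p^(m choose 2), the generating function is half the difference of two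
   Cauchy products, whose factors are evaluated by Euler's identities
     sum_k z^k / (p)_k = prod_i (1 - z p^i)^(-1)   and
     sum_k p^(k choose 2) z^k / (p)_k = prod_i (1 + z p^i).
   Both power series satisfy a functional equation linking z and zp, which iterates to the
   product because z p^n tends to 0. *)

theory Submission
  imports Defs
begin

section \<open>The q-factorials \<open>(p;p)_n\<close> and their nonvanishing\<close>

text \<open>The q-Pochhammer symbol \<open>(p;p)_n\<close> with base \<open>p\<close>. The field is
  left general because the group orders are evaluated over the reals and the generating function
  over the complex numbers.\<close>

definition qfac :: "'a::real_normed_field \<Rightarrow> nat \<Rightarrow> 'a" where
  "qfac p n = (\<Prod>i=1..n. 1 - p ^ i)"

lemma qfac_0 [simp]: "qfac p 0 = 1"
  by (simp add: qfac_def)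

lemma qfac_Suc: "qfac p (Suc n) = qfac p n * (1 - p ^ Suc n)"
  by (simp add: qfac_def)

lemma one_minus_power_nonzero:
  fixes p :: "'a::real_normed_field"
  assumes "norm p < 1"
  shows "1 - p ^ Suc n \<noteq> 0"
proof
  assume "1 - p ^ Suc n = 0"
  then have "p ^ Suc n = 1" by simp
  then have "norm p ^ Suc n = 1" by (metis norm_one norm_power)
  then show False
    using power_Suc_less_one[of "norm p" n] assms by (cases "p = 0") auto
qed

lemma qfac_nonzero:
  fixes p :: "'a::real_normed_field"
  assumes "norm p < 1"
  shows "qfac p n \<noteq> 0"
  using one_minus_power_nonzero[OF assms] by (induction n) (simp_all add: qfac_Suc)

section \<open>Convergence of Euler's series and products\<close>

text \<open>Ratio test in multiplicative form: any \<open>c\<close> strictly between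
  \<open>norm l\<close> and 1 eventually bounds the ratios. Absolute convergence is recorded because
  the Cauchy products require it.\<close>

lemma summable_norm_ratio_limit:
  fixes f :: "nat \<Rightarrow> 'a::real_normed_field"
  assumes step: "\<And>n. f (Suc n) = r n * f n" and lim: "r \<longlonglongrightarrow> l" and "norm l < 1"
  shows "summable (\<lambda>n. norm (f n))"
proof -
  obtain c where c: "norm l < c" "c < 1" using dense[OF assms(3)] by auto
  have "eventually (\<lambda>n. norm (r n) < c) sequentially"
    using order_tendstoD(2)[OF tendsto_norm[OF lim] c(1)] .
  then obtain N where N: "\<And>n. n \<ge> N \<Longrightarrow> norm (r n) < c"
    unfolding eventually_sequentially by blast
  show ?thesis
    by (rule summable_ratio_test[OF c(2), of N])
       (use N in \<open>simp add: step norm_mult less_imp_le mult_right_mono\<close>)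
qed

lemma LIMSEQ_one_minus_power_Suc:
  fixes p :: "'a::real_normed_field"
  assumes "norm p < 1"
  shows "(\<lambda>n. 1 - p ^ Suc n) \<longlonglongrightarrow> 1"
  using tendsto_diff[OF tendsto_const LIMSEQ_Suc[OF LIMSEQ_power_zero[OF assms]], of 1] by simp

lemma summable_norm_euler_inverse_prod:
  fixes p z :: "'a::real_normed_field"
  assumes "norm p < 1" "norm z < 1"
  shows "summable (\<lambda>n. norm (1 / qfac p n * z ^ n))"
proof (rule summable_norm_ratio_limit)
  show "1 / qfac p (Suc n) * z ^ Suc n = z / (1 - p ^ Suc n) * (1 / qfac p n * z ^ n)" for n
    by (simp add: qfac_Suc)
  show "(\<lambda>n. z / (1 - p ^ Suc n)) \<longlonglongrightarrow> z"
    using tendsto_divide[OF tendsto_const LIMSEQ_one_minus_power_Suc[OF assms(1)], of z] by simp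
qed fact

lemma Suc_choose_two: "Suc n choose 2 = (n choose 2) + n"
  by (simp add: numeral_2_eq_2)

lemma summable_norm_euler_prod:
  fixes p z :: "'a::real_normed_field"
  assumes "norm p < 1"
  shows "summable (\<lambda>n. norm (p ^ (n choose 2) / qfac p n * z ^ n))"
proof (rule summable_norm_ratio_limit)
  show "p ^ (Suc n choose 2) / qfac p (Suc n) * z ^ Suc n
      = z * p ^ n / (1 - p ^ Suc n) * (p ^ (n choose 2) / qfac p n * z ^ n)" for n
    by (simp add: qfac_Suc Suc_choose_two power_add mult_ac)
  show "(\<lambda>n. z * p ^ n / (1 - p ^ Suc n)) \<longlonglongrightarrow> 0"
    using tendsto_divide[OF tendsto_mult[OF tendsto_const LIMSEQ_power_zero[OF assms]]
        LIMSEQ_one_minus_power_Suc[OF assms], of z] by simp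
qed simp

text \<open>A power series that converges at some nonzero \<open>K\<close> is continuous at 0, and
  the arguments \<open>z * p ^ k\<close> tend to 0. This gives the limit when a functional equation
  linking \<open>z\<close> and \<open>z * p\<close> is iterated.\<close>

lemma LIMSEQ_powser_shrink:
  fixes a :: "nat \<Rightarrow> 'a::{real_normed_field,banach}"
  assumes "summable (\<lambda>n. a n * K ^ n)" "K \<noteq> 0" "norm p < 1"
  shows "(\<lambda>k. \<Sum>n. a n * (z * p ^ k) ^ n) \<longlonglongrightarrow> a 0"
proof -
  have "(\<lambda>k. z * p ^ k) \<longlonglongrightarrow> 0"
    using tendsto_mult[OF tendsto_const LIMSEQ_power_zero[OF assms(3)], of z] by simp
  moreover have "isCont (\<lambda>x. \<Sum>n. a n * x ^ n) 0"
    using isCont_powser[OF assms(1)] assms(2) by simp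
  ultimately have "(\<lambda>k. \<Sum>n. a n * (z * p ^ k) ^ n) \<longlonglongrightarrow> (\<Sum>n. a n * 0 ^ n)"
    using isCont_tendsto_compose[of 0 "\<lambda>x. \<Sum>n. a n * x ^ n"] by blast
  then show ?thesis by (simp only: powser_zero)
qed

lemma convergent_prod_geometric:
  fixes p z :: "'a::{real_normed_field,banach}"
  assumes "norm p < 1"
  shows "convergent_prod (\<lambda>i. 1 + z * p ^ i)"
proof -
  have "summable (\<lambda>i. norm z * norm p ^ i)"
    using assms by (intro summable_mult summable_geometric) simp
  then have "abs_convergent_prod (\<lambda>i. 1 + z * p ^ i)"
    by (intro summable_imp_abs_convergent_prod) (simp add: norm_mult norm_power)
  then show ?thesis
    by (rule abs_convergent_prod_imp_convergent_prod)
qed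

lemma LIMSEQ_prodinf_geometric:
  fixes p z :: "'a::{real_normed_field,banach}"
  assumes "norm p < 1"
  shows "(\<lambda>n. \<Prod>i<n. 1 + z * p ^ i) \<longlonglongrightarrow> (\<Prod>i. 1 + z * p ^ i)"
  using convergent_prod_LIMSEQ[OF convergent_prod_geometric[OF assms]]
  by (simp only: LIMSEQ_lessThan_iff_atMost)

text \<open>Splitting off the factor with index 0 shifts the parameter from \<open>z\<close> to
  \<open>z * p\<close>; this later relates the product for \<open>(u * Q)\<^sup>2\<close> to the one
  for \<open>u\<^sup>2\<close>.\<close>

lemma prodinf_geometric_head:
  fixes p z :: "'a::{real_normed_field,banach}"
  assumes "norm p < 1"
  shows "(\<Prod>i. 1 + z * p ^ i) = (1 + z) * (\<Prod>i. 1 + z * p * p ^ i)"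
  using has_prod_unique[OF has_prod_ignore_initial_segment'[OF convergent_prod_geometric[OF assms], of z 1]]
  by (simp add: mult_ac)

section \<open>Euler's two identities\<close>

text \<open>The recurrence \<open>a (Suc n) * (1 - p ^ Suc n) = a n * p ^ n\<close> amounts to
  \<open>G w = (1 + w) * G (w * p)\<close>. Iterating it splits off one factor of the product at a
  time.\<close>

lemma euler_prod_sums:
  fixes p z :: "'a::{real_normed_field,banach}"
  assumes p: "norm p < 1"
  shows "(\<lambda>n. p ^ (n choose 2) / qfac p n * z ^ n) sums (\<Prod>i. 1 + z * p ^ i)"
proof -
  define a where "a n = p ^ (n choose 2) / qfac p n" for n
  define G where "G w = (\<Sum>n. a n * w ^ n)" for w
  have summ: "summable (\<lambda>n. a n * w ^ n)" for w
    unfolding a_def by (rule summable_norm_cancel[OF summable_norm_euler_prod[OF p]])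
  have sums: "(\<lambda>n. a n * w ^ n) sums G w" for w
    unfolding G_def by (rule summable_sums[OF summ])
  have step: "G w = (1 + w) * G (w * p)" for w
  proof -
    have "(\<lambda>n. a n * w ^ n - a n * (w * p) ^ n) sums (G w - G (w * p))"
      by (intro sums_diff sums)
    moreover have "(\<lambda>n. a (Suc n) * w ^ Suc n - a (Suc n) * (w * p) ^ Suc n)
        = (\<lambda>n. w * (a n * (w * p) ^ n))"
    proof
      fix n
      have "a (Suc n) * w ^ Suc n - a (Suc n) * (w * p) ^ Suc n
          = a (Suc n) * (1 - p ^ Suc n) * w ^ Suc n"
        by (simp add: algebra_simps power_mult_distrib)
      also have "a (Suc n) * (1 - p ^ Suc n) = a n * p ^ n"
        using one_minus_power_nonzero[OF p, of n]
        by (simp add: a_def qfac_Suc Suc_choose_two power_add)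
      finally show "a (Suc n) * w ^ Suc n - a (Suc n) * (w * p) ^ Suc n = w * (a n * (w * p) ^ n)"
        by (simp add: power_mult_distrib)
    qed
    moreover have "(\<lambda>n. w * (a n * (w * p) ^ n)) sums (w * G (w * p))"
      by (intro sums_mult sums)
    \<comment> \<open>The difference series has constant term \<open>a 0 - a 0 = 0\<close>, so
      passing to its shift does not change the sum.\<close>
    ultimately have "G w - G (w * p) = w * G (w * p)"
      using sums_Suc[of "\<lambda>n. a n * w ^ n - a n * (w * p) ^ n"] sums_unique2 by fastforce
    then show ?thesis by (simp add: algebra_simps)
  qed
  have iter: "G z = (\<Prod>i<n. 1 + z * p ^ i) * G (z * p ^ n)" for n
  proof (induction n)
    case (Suc n)
    then show ?case
      by (simp only: step[of "z * p ^ n"] prod.lessThan_Suc power_Suc2 mult.assoc)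
  qed simp
  \<comment> \<open>The series converges everywhere, so \<open>1\<close> can serve as the nonzero
    point of convergence.\<close>
  have "(\<lambda>n. (\<Prod>i<n. 1 + z * p ^ i) * G (z * p ^ n)) \<longlonglongrightarrow> (\<Prod>i. 1 + z * p ^ i) * a 0"
    unfolding G_def
    by (intro tendsto_mult LIMSEQ_prodinf_geometric LIMSEQ_powser_shrink[of _ 1] summ p) simp
  then have "(\<lambda>n. G z) \<longlonglongrightarrow> (\<Prod>i. 1 + z * p ^ i) * a 0"
    by (simp only: iter[symmetric])
  then have "G z = (\<Prod>i. 1 + z * p ^ i)"
    by (simp add: a_def LIMSEQ_const_iff binomial_eq_0)
  with sums[of z] show ?thesis by (simp add: a_def)
qed

text \<open>Here the recurrence is \<open>a (Suc n) * (1 - p ^ Suc n) = a n\<close>, which gives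
  \<open>E (w * p) = (1 - w) * E w\<close> inside the unit disc.\<close>

lemma euler_inverse_prod_sums:
  fixes p z :: "'a::{real_normed_field,banach}"
  assumes p: "norm p < 1" and z: "norm z < 1"
  shows "(\<lambda>n. 1 / qfac p n * z ^ n) sums (1 / (\<Prod>i. 1 - z * p ^ i))"
proof -
  define a where "a n = 1 / qfac p n" for n
  define E where "E w = (\<Sum>n. a n * w ^ n)" for w
  have summ: "summable (\<lambda>n. a n * w ^ n)" if "norm w < 1" for w
    unfolding a_def by (rule summable_norm_cancel[OF summable_norm_euler_inverse_prod[OF p that]])
  have sums: "(\<lambda>n. a n * w ^ n) sums E w" if "norm w < 1" for w
    unfolding E_def by (rule summable_sums[OF summ[OF that]])
  have small: "norm (w * p) < 1" if "norm w < 1" for w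
    using mult_strict_mono'[of "norm w" 1 "norm p" 1] that p by (simp add: norm_mult)
  have step: "E (w * p) = (1 - w) * E w" if w: "norm w < 1" for w
  proof -
    have "(\<lambda>n. a n * w ^ n - a n * (w * p) ^ n) sums (E w - E (w * p))"
      by (intro sums_diff sums w small)
    moreover have "(\<lambda>n. a (Suc n) * w ^ Suc n - a (Suc n) * (w * p) ^ Suc n)
        = (\<lambda>n. w * (a n * w ^ n))"
    proof
      fix n
      have "a (Suc n) * w ^ Suc n - a (Suc n) * (w * p) ^ Suc n
          = a (Suc n) * (1 - p ^ Suc n) * w ^ Suc n"
        by (simp add: algebra_simps power_mult_distrib)
      also have "a (Suc n) * (1 - p ^ Suc n) = a n"
        using one_minus_power_nonzero[OF p, of n] by (simp add: a_def qfac_Suc)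
      finally show "a (Suc n) * w ^ Suc n - a (Suc n) * (w * p) ^ Suc n = w * (a n * w ^ n)"
        by simp
    qed
    moreover have "(\<lambda>n. w * (a n * w ^ n)) sums (w * E w)"
      by (intro sums_mult sums w)
    ultimately have "E w - E (w * p) = w * E w"
      using sums_Suc[of "\<lambda>n. a n * w ^ n - a n * (w * p) ^ n"] sums_unique2 by fastforce
    then show ?thesis by (simp add: algebra_simps)
  qed
  have small': "norm (z * p ^ n) < 1" for n
  proof (induction n)
    case (Suc n)
    then show ?case using small[of "z * p ^ n"] by (simp add: mult_ac)
  qed (use z in simp)
  \<comment> \<open>The product stays on the side of \<open>E z\<close>, so nothing is divided by
    factors not yet known to be nonzero. The form \<open>1 + (- z) * p ^ i\<close> matches
    \<open>LIMSEQ_prodinf_geometric\<close>.\<close>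
  have "E (z * p ^ n) = (\<Prod>i<n. 1 + (- z) * p ^ i) * E z" for n
  proof (induction n)
    case (Suc n)
    then show ?case using step[OF small'[of n]] by (simp add: mult_ac)
  qed simp
  moreover have "(\<lambda>n. (\<Prod>i<n. 1 + (- z) * p ^ i) * E z) \<longlonglongrightarrow> (\<Prod>i. 1 + (- z) * p ^ i) * E z"
    by (intro tendsto_mult LIMSEQ_prodinf_geometric p tendsto_const)
  moreover have "(\<lambda>n. E (z * p ^ n)) \<longlonglongrightarrow> a 0"
    unfolding E_def by (rule LIMSEQ_powser_shrink[of _ "1/2"]) (use p in \<open>auto intro: summ\<close>)
  \<comment> \<open>This equation also shows that the infinite product is nonzero, which justifies
    the division that follows.\<close>
  ultimately have "(\<Prod>i. 1 - z * p ^ i) * E z = 1"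
    using LIMSEQ_unique by (fastforce simp: a_def)
  then have "E z = 1 / (\<Prod>i. 1 - z * p ^ i)"
    by (metis mult_zero_left nonzero_eq_divide_eq mult.commute zero_neq_one)
  with sums[OF z] show ?thesis by (simp add: a_def)
qed

text \<open>Each series is spread over one parity class and padded with zeros, which does not change
  its sum. This allows a single index \<open>r\<close> whose summand depends on
  \<open>r div 2\<close> and on the parity of \<open>r\<close>.\<close>

lemma sums_even_odd:
  fixes f g :: "nat \<Rightarrow> 'a::real_normed_vector"
  assumes "f sums x" "g sums y"
  shows "(\<lambda>n. if even n then f (n div 2) else g (n div 2)) sums (x + y)"
proof -
  have "(\<lambda>n. if even n then f (n div 2) else 0) sums x"
    using assms(1)
    by (subst sums_mono_reindex[of "\<lambda>n. 2 * n", symmetric]) (auto simp: strict_mono_def elim!: evenE)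
  moreover have "(\<lambda>n. if even n then 0 else g (n div 2)) sums y"
    using assms(2)
    by (subst sums_mono_reindex[of "\<lambda>n. 2 * n + 1", symmetric]) (auto simp: strict_mono_def elim!: oddE)
  ultimately have "(\<lambda>n. (if even n then f (n div 2) else 0) + (if even n then 0 else g (n div 2)))
      sums (x + y)"
    by (rule sums_add)
  also have "(\<lambda>n. (if even n then f (n div 2) else 0) + (if even n then 0 else g (n div 2)))
      = (\<lambda>n. if even n then f (n div 2) else g (n div 2))"
    by auto
  finally show ?thesis .
qed

section \<open>Group orders and the three denominators as powers of \<open>q\<close> times
  q-factorials\<close>

lemma power_double_minus_one:
  fixes q :: real
  assumes "q \<noteq> 0"
  shows "q ^ (2 * n) - 1 = q ^ (2 * n) * (1 - (1 / q\<^sup>2) ^ n)"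
  using assms by (simp add: right_diff_distrib power_mult power_one_over)

text \<open>Extracting \<open>q ^ (2 * i)\<close> from each factor leaves \<open>1 - p ^ i\<close>
  with \<open>p = 1 / q\<^sup>2\<close>; the extracted exponents \<open>2 + 4 + ... + 2 * m\<close>
  add up to \<open>m\<^sup>2 + m\<close>.\<close>

lemma prod_power_minus_one_conv_qfac:
  fixes q :: real
  assumes "q \<noteq> 0"
  shows "(\<Prod>i=1..m. q ^ (2 * i) - 1) = q ^ (m\<^sup>2 + m) * qfac (1 / q\<^sup>2) m"
proof (induction m)
  case (Suc m)
  have e: "(Suc m)\<^sup>2 + Suc m = (m\<^sup>2 + m) + 2 * Suc m"
    by (simp add: power2_eq_square)
  show ?case
    unfolding e using power_double_minus_one[OF assms, of "Suc m"]
Suc.IH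
    by (simp add: qfac_Suc power_add del: power_Suc mult_Suc_right)
qed simp

lemma ord_Sp_conv_qfac:
  assumes "q \<noteq> 0"
  shows "ord_Sp (2 * m) q = q ^ (2 * m\<^sup>2 + m) * qfac (1 / q\<^sup>2) m"
proof -
  have e: "2 * m\<^sup>2 + m = m\<^sup>2 + (m\<^sup>2 + m)" and d: "2 * m div 2 = m" by simp_all
  show ?thesis
    unfolding ord_Sp_def Let_def d prod_power_minus_one_conv_qfac[OF assms] e
    by (simp add: power_add)
qed

lemma ord_Om_conv_qfac:
  assumes "q \<noteq> 0"
  shows "ord_Om (2 * m) q = 2 * q ^ (2 * m\<^sup>2) / (q ^ m - 1) * qfac (1 / q\<^sup>2) m"
proof -
  have "m \<le> m\<^sup>2" by (simp add: power2_eq_square)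
  then have e: "2 * m\<^sup>2 = (m\<^sup>2 - m) + (m\<^sup>2 + m)" by simp
  have d: "2 * m div 2 = m" by simp
  show ?thesis
    unfolding ord_Om_def Let_def d prod_power_minus_one_conv_qfac[OF assms] e
    by (simp add: power_add)
qed

text \<open>With \<open>n = 2 * s + m\<close> all exponents of \<open>q\<close> collect to
  \<open>n\<^sup>2 + m\<^sup>2\<close>, so the weight \<open>q ^ n\<^sup>2\<close> will cancel and
  leave only \<open>q ^ m\<^sup>2\<close>.\<close>

lemma A_term_even:
  assumes "q \<noteq> 0"
  shows "A_term q (2 * s + m) (2 * s)
    = 2 * q ^ ((2 * s + m)\<^sup>2 + m\<^sup>2) / (q ^ m - 1) * qfac (1 / q\<^sup>2) s * qfac (1 / q\<^sup>2) m"
proof -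
  have d: "2 * s * (2 * s - 1) div 2 = s * (2 * s - 1)" by simp
  \<comment> \<open>The proof splits on \<open>s\<close> because \<open>2 * s - 1\<close> is
    truncated at \<open>s = 0\<close>.\<close>
  have e: "(s * (2 * s - 1) + 2 * s * (2 * m)) + (2 * s\<^sup>2 + s) + 2 * m\<^sup>2 = (2 * s + m)\<^sup>2 + m\<^sup>2"
    by (cases s) (simp_all add: power2_eq_square algebra_simps)
  have "A_term q (2 * s + m) (2 * s)
      = q ^ (s * (2 * s - 1) + 2 * s * (2 * m)) * ord_Sp (2 * s) q * ord_Om (2 * m) q"
    by (simp add: A_term_def d)
  then show ?thesis
    by (simp add: ord_Sp_conv_qfac[OF assms] ord_Om_conv_qfac[OF assms] e[symmetric] power_add)
qed

text \<open>The factor \<open>q ^ n\<close>, with \<open>n = 2 * Suc t + m\<close>, raises the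
  exponent to the same \<open>n\<^sup>2 + m\<^sup>2\<close> without subtraction. Even
  \<open>r\<close> starts at 2 here, hence \<open>Suc t\<close>, and \<open>t\<close> is the rank of
  the smaller symplectic factor \<open>ord_Sp (r - 2)\<close>.\<close>

lemma B_term_even:
  assumes "q \<noteq> 0"
  shows "B_term q (2 * Suc t + m) (2 * Suc t) * q ^ (2 * Suc t + m)
    = 2 * q ^ ((2 * Suc t + m)\<^sup>2 + m\<^sup>2) * qfac (1 / q\<^sup>2) t * qfac (1 / q\<^sup>2) m"
proof -
  have d: "2 * Suc t * (2 * Suc t + 1) div 2 = Suc t * (2 * t + 3)"
    by (simp add: algebra_simps)
  have e: "(Suc t * (2 * t + 3) + (2 * t + 1) * (2 * m) - 1) + (2 * t\<^sup>2 + t) + (2 * m\<^sup>2 + m) + (2 * Suc t + m)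
      = (2 * Suc t + m)\<^sup>2 + m\<^sup>2"
    by (simp add: power2_eq_square algebra_simps)
  have "B_term q (2 * Suc t + m) (2 * Suc t)
      = 2 * q ^ (Suc t * (2 * t + 3) + (2 * t + 1) * (2 * m) - 1) * ord_Sp (2 * t) q * ord_Sp (2 * m) q"
    unfolding B_term_def d by simp
  then have "B_term q (2 * Suc t + m) (2 * Suc t) * q ^ (2 * Suc t + m)
      = 2 * (q ^ (Suc t * (2 * t + 3) + (2 * t + 1) * (2 * m) - 1) * q ^ (2 * t\<^sup>2 + t)
          * q ^ (2 * m\<^sup>2 + m) * q ^ (2 * Suc t + m))
        * qfac (1 / q\<^sup>2) t * qfac (1 / q\<^sup>2) m"
    by (simp only: ord_Sp_conv_qfac[OF assms]) (simp only: mult_ac)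
  then show ?thesis
    by (simp only: e flip: power_add)
qed

lemma C_term_odd:
  assumes "q \<noteq> 0"
  shows "C_term q (2 * s + 1 + m) (2 * s + 1) * q ^ (2 * s + 1 + m)
    = 2 * q ^ ((2 * s + 1 + m)\<^sup>2 + m\<^sup>2) * qfac (1 / q\<^sup>2) s * qfac (1 / q\<^sup>2) m"
proof -
  have d: "(2 * s + 1) * (2 * s + 1 - 1) div 2 = (2 * s + 1) * s" by simp
  have e: "((2 * s + 1) * s + 2 * s * (2 * m)) + (2 * s\<^sup>2 + s) + (2 * m\<^sup>2 + m) + (2 * s + 1 + m)
      = (2 * s + 1 + m)\<^sup>2 + m\<^sup>2"
    by (simp add: power2_eq_square algebra_simps)
  have "C_term q (2 * s + 1 + m) (2 * s + 1)
      = 2 * q ^ ((2 * s + 1) * s + 2 * s * (2 * m)) * ord_Sp (2 * s) q * ord_Sp (2 * m) q"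
    unfolding C_term_def d by simp
  then have "C_term q (2 * s + 1 + m) (2 * s + 1) * q ^ (2 * s + 1 + m)
      = 2 * (q ^ ((2 * s + 1) * s + 2 * s * (2 * m)) * q ^ (2 * s\<^sup>2 + s)
          * q ^ (2 * m\<^sup>2 + m) * q ^ (2 * s + 1 + m))
        * qfac (1 / q\<^sup>2) s * qfac (1 / q\<^sup>2) m"
    by (simp only: ord_Sp_conv_qfac[OF assms]) (simp only: mult_ac)
  then show ?thesis
    by (simp only: e flip: power_add)
qed

section \<open>Reciprocals of the terms and the convolution form of the coefficients\<close>

text \<open>Over the common denominator \<open>D\<close> the numerators are \<open>q ^ m - 1\<close>
  and \<open>q ^ n - q ^ m\<close> with \<open>n = 2 * s + m\<close>, and they telescope. The first
  vanishes at \<open>m = 0\<close> and the second at \<open>s = 0\<close>, so the excluded indices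
  fit the same formula.\<close>

lemma even_terms:
  assumes q: "q > 1"
  shows "(if m = 0 then 0 else 1 / A_term q (2 * s + m) (2 * s))
       + (if s = 0 then 0 else 1 / B_term q (2 * s + m) (2 * s))
    = (q ^ (2 * s + m) - 1)
      / (2 * q ^ ((2 * s + m)\<^sup>2 + m\<^sup>2) * qfac (1 / q\<^sup>2) s * qfac (1 / q\<^sup>2) m)"
proof -
  define D where "D = 2 * q ^ ((2 * s + m)\<^sup>2 + m\<^sup>2) * qfac (1 / q\<^sup>2) s * qfac (1 / q\<^sup>2) m"
  have "norm (1 / q\<^sup>2) < 1"
    using q by (simp add: one_less_power)
  note nz = qfac_nonzero[OF this]
  have "(if m = 0 then 0 else 1 / A_term q (2 * s + m) (2 * s)) = (q ^ m - 1) / D"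
    using q by (simp add: A_term_even D_def)
  moreover have "(if s = 0 then 0 else 1 / B_term q (2 * s + m) (2 * s))
      = (q ^ (2 * s + m) - q ^ m) / D"
  proof (cases s)
    case (Suc t)
    \<comment> \<open>The last factor of \<open>qfac\<close> at \<open>s\<close> turns
      \<open>q ^ (2 * s)\<close> into \<open>q ^ (2 * s) - 1\<close>; this accounts for the rank
      \<open>s - 1\<close> in \<open>B_term\<close> and yields the numerator
      \<open>q ^ n - q ^ m\<close>.\<close>
    have X: "qfac (1 / q\<^sup>2) s * q ^ (2 * s) = qfac (1 / q\<^sup>2) t * (q ^ (2 * s) - 1)"
      using q power_double_minus_one[of q s] by (simp only: Suc qfac_Suc) simp
    have Y: "q ^ (2 * s + m) - q ^ m = (q ^ (2 * s) - 1) * q ^ m"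
      by (simp add: power_add algebra_simps)
    have "D * q ^ (2 * s + m)
        = 2 * q ^ ((2 * s + m)\<^sup>2 + m\<^sup>2) * qfac (1 / q\<^sup>2) m * q ^ m
          * (qfac (1 / q\<^sup>2) s * q ^ (2 * s))"
      unfolding D_def power_add[of q "2 * s" m] by (simp only: mult_ac)
    also have "\<dots> = (2 * q ^ ((2 * s + m)\<^sup>2 + m\<^sup>2) * qfac (1 / q\<^sup>2) t * qfac (1 / q\<^sup>2) m)
          * (q ^ (2 * s + m) - q ^ m)"
      unfolding X Y by (simp only: mult_ac)
    also have "\<dots> = B_term q (2 * s + m) (2 * s) * q ^ (2 * s + m) * (q ^ (2 * s + m) - q ^ m)"
      using B_term_even[of q t m] q by (simp only: Suc)
    finally have D: "D = B_term q (2 * s + m) (2 * s) * (q ^ (2 * s + m) - q ^ m)"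
      using q by simp
    moreover have "D \<noteq> 0"
      using q nz by (simp add: D_def)
    ultimately have "q ^ (2 * s + m) - q ^ m \<noteq> 0" by fastforce
    then have "1 / B_term q (2 * s + m) (2 * s) = (q ^ (2 * s + m) - q ^ m) / D"
      unfolding D by simp
    then show ?thesis
      using Suc by simp
  qed simp
  ultimately show ?thesis
    unfolding D_def[symmetric] by (simp add: diff_divide_distrib)
qed

lemma odd_term:
  assumes q: "q > 1"
  shows "1 / C_term q (2 * s + 1 + m) (2 * s + 1) = q ^ (2 * s + 1 + m)
    / (2 * q ^ ((2 * s + 1 + m)\<^sup>2 + m\<^sup>2) * qfac (1 / q\<^sup>2) s * qfac (1 / q\<^sup>2) m)"
proof -
  have "q \<noteq> 0" using q by simp
  then show ?thesis
    by (subst C_term_odd[symmetric]) simp_all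
qed

lemma choose_two_square: "2 * (m choose 2) + m = m\<^sup>2"
  by (induction m) (simp_all add: Suc_choose_two power2_eq_square binomial_eq_0)

text \<open>Since \<open>m\<^sup>2 = 2 * (m choose 2) + m\<close>, both quotients become Euler
  coefficients. A surviving \<open>1 / q ^ m\<close> moves the argument of the second Euler series
  from \<open>u\<close> to \<open>u / q\<close>.\<close>

lemma power_square_conv_choose_two:
  fixes q :: real
  assumes "q \<noteq> 0"
  shows "1 / q ^ m\<^sup>2 = (1 / q\<^sup>2) ^ (m choose 2) * (1 / q) ^ m"
    and "q ^ m / q ^ m\<^sup>2 = (1 / q\<^sup>2) ^ (m choose 2)"
  using assms
  by (simp_all add: choose_two_square[of m, symmetric] power_add power_mult power_one_over)

text \<open>Index \<open>r\<close> contributes \<open>q ^ n\<close> minus 1 or 0 according to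
  parity, over one denominator. Splitting \<open>q ^ n = q ^ r * q ^ (n - r)\<close> separates the
  dependence on \<open>r\<close> from that on \<open>n - r\<close>.\<close>

lemma weighted_sum_conv_convolution:
  fixes q :: real
  assumes q: "q > 1"
  defines "p \<equiv> 1 / q\<^sup>2"
  shows "q ^ n\<^sup>2 * ((\<Sum>r | r < n \<and> even r. 1 / A_term q n r)
                   + (\<Sum>r | 1 \<le> r \<and> r \<le> n \<and> even r. 1 / B_term q n r)
                   + (\<Sum>r | 1 \<le> r \<and> r \<le> n \<and> odd r. 1 / C_term q n r))
    = (\<Sum>r\<le>n. 1 / 2 * (q ^ r / qfac p (r div 2) * (p ^ (n - r choose 2) / qfac p (n - r)))
        - 1 / 2 * ((if even r then 1 / qfac p (r div 2) else 0)
            * (p ^ (n - r choose 2) / qfac p (n - r) * (1 / q) ^ (n - r))))"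
proof -
  \<comment> \<open>Padding with zeros puts the three sums on the range \<open>{..n}\<close>, where
    they can be added termwise.\<close>
  have filt: "(\<Sum>r | P r. f r) = (\<Sum>r\<le>n. if P r then f r else 0)"
    if "\<And>r. P r \<Longrightarrow> r \<le> n" for P and f :: "nat \<Rightarrow> real"
    using that by (intro sum.mono_neutral_cong_left) auto
  define T where "T r = (if r < n \<and> even r then 1 / A_term q n r else 0)
      + (if 1 \<le> r \<and> r \<le> n \<and> even r then 1 / B_term q n r else 0)
      + (if 1 \<le> r \<and> r \<le> n \<and> odd r then 1 / C_term q n r else 0)" for r
  have main: "q ^ n\<^sup>2 * T r = 1 / 2 * (q ^ r / qfac p (r div 2) * (p ^ (n - r choose 2) / qfac p (n - r)))
        - 1 / 2 * ((if even r then 1 / qfac p (r div 2) else 0)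
            * (p ^ (n - r choose 2) / qfac p (n - r) * (1 / q) ^ (n - r)))"
    (is "?lhs = ?rhs") if "r \<le> n" for r
  proof -
    define m s where "m = n - r" and "s = r div 2"
    have n: "n = r + m" using that by (simp add: m_def)
    have m': "n - r = m" by (simp add: m_def)
    have "q \<noteq> 0" using q by simp
    note e = power_square_conv_choose_two[OF this, of m, folded p_def]
    have "?lhs = (q ^ n - (if even r then 1 else 0)) / (2 * q ^ m\<^sup>2 * qfac p s * qfac p m)"
    proof (cases "even r")
      case True
      then have r: "r = 2 * s" by (simp add: s_def)
      have "?lhs = q ^ n\<^sup>2 * ((if m = 0 then 0 else 1 / A_term q (2 * s + m) (2 * s))
          + (if s = 0 then 0 else 1 / B_term q (2 * s + m) (2 * s)))"
        by (simp add: T_def n r)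
      also have "\<dots> = q ^ n\<^sup>2 * ((q ^ n - 1) / (2 * q ^ (n\<^sup>2 + m\<^sup>2) * qfac p s * qfac p m))"
        unfolding even_terms[OF q] by (simp only: n r p_def)
      finally show ?thesis
        using True q by (simp add: power_add)
    next
      case False
      then have r: "r = 2 * s + 1" by (simp add: s_def)
      have "?lhs = q ^ n\<^sup>2 * (1 / C_term q (2 * s + 1 + m) (2 * s + 1))"
        by (simp add: T_def n r)
      also have "\<dots> = q ^ n\<^sup>2 * (q ^ n / (2 * q ^ (n\<^sup>2 + m\<^sup>2) * qfac p s * qfac p m))"
        unfolding odd_term[OF q] by (simp only: n r p_def)
      finally show ?thesis
        using False q by (simp add: power_add)
    qed
    also have "\<dots> = 1 / 2 * (q ^ r / qfac p s * ((q ^ m / q ^ m\<^sup>2) / qfac p m))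
        - 1 / 2 * ((if even r then 1 / qfac p s else 0) * ((1 / q ^ m\<^sup>2) / qfac p m))"
      by (simp add: n power_add diff_divide_distrib mult_ac)
    also have "\<dots> = ?rhs"
      unfolding e m' s_def by (simp add: mult_ac)
    finally show ?thesis .
  qed
  have "(\<Sum>r | r < n \<and> even r. 1 / A_term q n r)
      + (\<Sum>r | 1 \<le> r \<and> r \<le> n \<and> even r. 1 / B_term q n r)
      + (\<Sum>r | 1 \<le> r \<and> r \<le> n \<and> odd r. 1 / C_term q n r) = (\<Sum>r\<le>n. T r)"
    unfolding T_def sum.distrib by (intro arg_cong2[of _ _ _ _ "(+)"] filt) simp_all
  then show ?thesis
    by (simp only: sum_distrib_left) (intro sum.cong refl main, simp)
qed

section \<open>The generating function as a difference of two Cauchy products\<close>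

theorem theorem2p15:
  fixes q :: real and u :: complex
  assumes "q > 1" and "norm u < 1 / q"
  shows "(\<lambda>n. of_real q ^ (n\<^sup>2) * u ^ n *
            of_real ((\<Sum>r | r < n \<and> even r. 1 / A_term q n r)
                   + (\<Sum>r | 1 \<le> r \<and> r \<le> n \<and> even r. 1 / B_term q n r)
                   + (\<Sum>r | 1 \<le> r \<and> r \<le> n \<and> odd r. 1 / C_term q n r)))
         sums
         (1 / (2 * (1 - u * of_real q))
            * ((\<Prod>i. 1 + u / of_real q ^ (2 * i)) / (\<Prod>i. 1 - u\<^sup>2 / of_real q ^ (2 * i)))
          - 1 / 2
            * ((\<Prod>i. 1 + u / of_real q ^ (2 * i + 1)) / (\<Prod>i. 1 - u\<^sup>2 / of_real q ^ (2 * i))))"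
proof -
  define Q p where "Q = complex_of_real q" and "p = 1 / Q\<^sup>2"
  define P where "P = (\<Prod>i. 1 - u\<^sup>2 * p ^ i)"
  define a1 where "a1 k = 1 / qfac p k * ((u * Q)\<^sup>2) ^ k" for k
  define a2 where "a2 k = 1 / qfac p k * (u\<^sup>2) ^ k" for k
  \<comment> \<open>\<open>F\<close> interleaves the first Euler series at
    \<open>(u * Q)\<^sup>2\<close> with \<open>u * Q\<close> times itself, so that
    \<open>F r\<close> is \<open>(u * Q) ^ r / qfac p (r div 2)\<close> for both parities.
    \<open>G\<close> is supported on even indices, with argument \<open>u\<^sup>2\<close>.\<close>
  define F where "F r = (if even r then a1 (r div 2) else u * Q * a1 (r div 2))" for r
  define G where "G r = (if even r then a2 (r div 2) else 0)" for r
  define H where "H w m = p ^ (m choose 2) / qfac p m * w ^ m" for w m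
  have Q: "Q \<noteq> 0" and normQ: "norm Q = q" using assms(1) by (simp_all add: Q_def)
  have p: "norm p < 1"
    using assms(1) by (simp add: p_def norm_divide norm_power normQ one_less_power)
  have p_real: "p = of_real (1 / q\<^sup>2)" by (simp add: p_def Q_def)
  have uQ: "norm (u * Q) < 1"
    using assms by (simp add: norm_mult normQ field_simps)
  then have uQ2: "norm ((u * Q)\<^sup>2) < 1"
    by (simp add: norm_power power_less_one_iff abs_square_less_1)
  have "1 / q < 1"
    using assms(1) by simp
  then have "norm u < 1"
    using assms(2) by linarith
  then have u2: "norm (u\<^sup>2) < 1"
    by (simp add: norm_power power_less_one_iff abs_square_less_1)

  have F_sums: "F sums ((1 + u * Q) * (1 / (\<Prod>i. 1 - (u * Q)\<^sup>2 * p ^ i)))"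
    using sums_even_odd[OF euler_inverse_prod_sums[OF p uQ2] sums_mult[OF euler_inverse_prod_sums[OF p uQ2], of "u * Q"]]
    unfolding F_def a1_def distrib_right by simp
  have G_sums: "G sums (1 / P)"
    using sums_even_odd[OF euler_inverse_prod_sums[OF p u2] sums_zero]
    unfolding G_def a2_def P_def by simp
  have H_sums: "H w sums (\<Prod>i. 1 + w * p ^ i)" for w
    unfolding H_def by (rule euler_prod_sums[OF p])
  have "summable (\<lambda>n. if even n then norm (a1 (n div 2)) else norm (u * Q) * norm (a1 (n div 2)))"
    using sums_even_odd[OF summable_sums[OF summable_norm_euler_inverse_prod[OF p uQ2]]
        summable_sums[OF summable_mult[OF summable_norm_euler_inverse_prod[OF p uQ2], of "norm (u * Q)"]]]
    unfolding a1_def by (rule sums_summable)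
  then have F_norm: "summable (\<lambda>r. norm (F r))"
    by (simp add: F_def norm_mult if_distrib cong: if_cong)
  have "summable (\<lambda>n. if even n then norm (a2 (n div 2)) else 0)"
    using sums_even_odd[OF summable_sums[OF summable_norm_euler_inverse_prod[OF p u2]] sums_zero]
    unfolding a2_def by (rule sums_summable)
  then have G_norm: "summable (\<lambda>r. norm (G r))"
    by (simp add: G_def if_distrib cong: if_cong)
  have H_norm: "summable (\<lambda>m. norm (H w m))" for w
    unfolding H_def by (rule summable_norm_euler_prod[OF p])

  have F_eq: "F r = Q ^ r / qfac p (r div 2) * u ^ r" for r
  proof (cases "even r")
    case True
    then show ?thesis
      by (auto simp: F_def a1_def power_mult_distrib power_mult elim!: evenE)
  next
    case False
    then show ?thesis
      by (auto simp: F_def a1_def power_mult_distrib power_mult power_add elim!: oddE)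
  qed
  have G_eq: "G r = (if even r then 1 / qfac p (r div 2) else 0) * u ^ r" for r
    by (auto simp: G_def a2_def power_mult elim!: evenE)
  have qfac_real: "complex_of_real (qfac (1 / q\<^sup>2) k) = qfac p k" for k
    by (simp add: qfac_def p_real)

  have terms: "of_real q ^ (n\<^sup>2) * u ^ n *
            of_real ((\<Sum>r | r < n \<and> even r. 1 / A_term q n r)
                   + (\<Sum>r | 1 \<le> r \<and> r \<le> n \<and> even r. 1 / B_term q n r)
                   + (\<Sum>r | 1 \<le> r \<and> r \<le> n \<and> odd r. 1 / C_term q n r))
      = 1 / 2 * (\<Sum>r\<le>n. F r * H u (n - r)) - 1 / 2 * (\<Sum>r\<le>n. G r * H (u / Q) (n - r))"
    (is "_ * _ * of_real ?S = ?rhs") for n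
  proof -
    \<comment> \<open>The coefficient apart from \<open>u ^ n\<close> is real, so the real
      convolution formula applies before embedding into the complex numbers.\<close>
    have "of_real q ^ (n\<^sup>2) * u ^ n * of_real ?S = of_real (q ^ n\<^sup>2 * ?S) * u ^ n"
      by simp
    also have "\<dots> = (\<Sum>r\<le>n. (1 / 2 * (Q ^ r / qfac p (r div 2) * (p ^ (n - r choose 2) / qfac p (n - r)))
        - 1 / 2 * ((if even r then 1 / qfac p (r div 2) else 0)
            * (p ^ (n - r choose 2) / qfac p (n - r) * (1 / Q) ^ (n - r)))) * u ^ n)"
      unfolding weighted_sum_conv_convolution[OF assms(1)] of_real_sum sum_distrib_right
      by (intro sum.cong refl) (simp add: qfac_real p_def Q_def)
    also have "\<dots> = (\<Sum>r\<le>n. 1 / 2 * (F r * H u (n - r)) - 1 / 2 * (G r * H (u / Q) (n - r)))"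
    proof (rule sum.cong)
      fix r assume "r \<in> {..n}"
      then have un: "u ^ n = u ^ r * u ^ (n - r)" by (simp flip: power_add)
      show "(1 / 2 * (Q ^ r / qfac p (r div 2) * (p ^ (n - r choose 2) / qfac p (n - r)))
        - 1 / 2 * ((if even r then 1 / qfac p (r div 2) else 0)
            * (p ^ (n - r choose 2) / qfac p (n - r) * (1 / Q) ^ (n - r)))) * u ^ n
        = 1 / 2 * (F r * H u (n - r)) - 1 / 2 * (G r * H (u / Q) (n - r))"
        unfolding F_eq G_eq H_def un
        by (cases "even r") (simp_all add: power_divide left_diff_distrib right_diff_distrib mult_ac)
    qed simp
    finally show ?thesis
      by (simp only: sum_subtractf sum_distrib_left)
  qed

  have "(\<lambda>n. \<Sum>r\<le>n. F r * H u (n - r)) sums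
      ((1 + u * Q) * (1 / (\<Prod>i. 1 - (u * Q)\<^sup>2 * p ^ i)) * (\<Prod>i. 1 + u * p ^ i))"
    using Cauchy_product_sums[OF F_norm H_norm] by (simp only: sums_unique[OF F_sums] sums_unique[OF H_sums])
  moreover have "(\<lambda>n. \<Sum>r\<le>n. G r * H (u / Q) (n - r)) sums (1 / P * (\<Prod>i. 1 + u / Q * p ^ i))"
    using Cauchy_product_sums[OF G_norm H_norm] by (simp only: sums_unique[OF G_sums] sums_unique[OF H_sums])
  ultimately have sums: "(\<lambda>n. 1 / 2 * (\<Sum>r\<le>n. F r * H u (n - r)) - 1 / 2 * (\<Sum>r\<le>n. G r * H (u / Q) (n - r)))
    sums (1 / 2 * ((1 + u * Q) * (1 / (\<Prod>i. 1 - (u * Q)\<^sup>2 * p ^ i)) * (\<Prod>i. 1 + u * p ^ i))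
        - 1 / 2 * (1 / P * (\<Prod>i. 1 + u / Q * p ^ i)))"
    by (intro sums_diff sums_mult)
  \<comment> \<open>The product for \<open>(u * Q)\<^sup>2\<close> has first factor
    \<open>(1 + u * Q) * (1 - u * Q)\<close> and tail \<open>P\<close>; the factor
    \<open>1 + u * Q\<close> from the parity split cancels.\<close>
  have head: "(1 + u * Q) * (1 / (\<Prod>i. 1 - (u * Q)\<^sup>2 * p ^ i)) = 1 / ((1 - u * Q) * P)"
  proof -
    have "(u * Q)\<^sup>2 * p = u\<^sup>2"
      using Q by (simp add: p_def power_mult_distrib)
    then have "(\<Prod>i. 1 - (u * Q)\<^sup>2 * p ^ i) = (1 - (u * Q)\<^sup>2) * P"
      using prodinf_geometric_head[OF p, of "- ((u * Q)\<^sup>2)"] by (simp add: P_def)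
    also have "1 - (u * Q)\<^sup>2 = (1 + u * Q) * (1 - u * Q)"
      by (simp add: power2_eq_square algebra_simps)
    finally have eq: "(\<Prod>i. 1 - (u * Q)\<^sup>2 * p ^ i) = (1 + u * Q) * ((1 - u * Q) * P)"
      by (simp only: mult.assoc)
    \<comment> \<open>Otherwise \<open>u * Q = -1\<close> would have norm 1.\<close>
    have "1 + u * Q \<noteq> 0"
      using uQ by (metis add_eq_0_iff less_irrefl norm_minus_cancel norm_one)
    then show ?thesis
      unfolding eq by simp
  qed
  have p_power: "p ^ i = 1 / of_real q ^ (2 * i)" for i
    by (simp add: p_def Q_def power_one_over power_mult)
  have prods: "(\<Prod>i. 1 + u / of_real q ^ (2 * i)) = (\<Prod>i. 1 + u * p ^ i)"
    "(\<Prod>i. 1 + u / of_real q ^ (2 * i + 1)) = (\<Prod>i. 1 + u / Q * p ^ i)"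
    "(\<Prod>i. 1 - u\<^sup>2 / of_real q ^ (2 * i)) = P"
    by (simp_all add: p_power P_def Q_def)
  have fractions: "1 / (2 * c) * (A / P) = 1 / 2 * (1 / (c * P) * A)"
    "1 / 2 * (A / P) = 1 / 2 * (1 / P * A)" for c A :: complex
    by simp_all
  show ?thesis
    unfolding terms prods fractions unfolding Q_def[symmetric] by (rule sums[unfolded head])
qed

end
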